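(* Every non-elementary convergence group $\Gamma$ is not invariably generated; that is, there is a proper subgroup $H\lneqq\Gamma$ which meets every conjugacy class of $\Gamma$.
   Context: All actions are by homeomorphisms. Let a group $\Gamma$ act on a compact Hausdorff space $X$. An infinite subset $\Phi\subset\Gamma$ is collapsing if there are (not necessarily distinct) points $a,r\in X$ such that for all compact sets $K\subset X\setminus\{r\}$ and $L\subset X\setminus\{a\}$ the set $\{\phi\in\Phi:\phi\cdot K\cap L\neq\emptyset\}$ is finite. The action is a convergence action if every infinite subset $\Phi\subset\Gamma$ contains an infinite collapsing subset $\Phi'\subset\Phi$. A convergence group is a group admitting a convergence action on some compact metrizable space $X$ with more than two points. It is elementary if $\Gamma$ is finite or $\Gamma$ stabilizes (setwise) a nonempty subset of $X$ with at most $2$ elements; otherwise it is non-elementary. The action is not assumed to be faithful or minimal. A subset $S$ of a group $G$ invariably generates $G$ if $G=\langle s^{g(s)}: s\in S\rangle$ for every choice of elements $g(s)\in G$, $s\in S$, where $s^{g}$ denotes the conjugate of $s$ by $g$. A group $G$ is invariably generated (IG) if some subset $S$ invariably generates $G$; equivalently, if $S=G$ invariably generates $G$; equivalently, if no proper subgroup of $G$ meets every conjugacy class of $G$. *)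

theory Defs
  imports "HOL-Analysis.Analysis" "HOL-Algebra.Group_Action" "HOL-Algebra.Generated_Groups"
begin

section \<open>Convergence actions\<close>

definition action_by_homeomorphisms ::
    "('a, 'c) monoid_scheme \<Rightarrow> 'x topology \<Rightarrow> ('a \<Rightarrow> 'x \<Rightarrow> 'x) \<Rightarrow> bool"
  where "action_by_homeomorphisms G X \<phi> \<longleftrightarrow>
    group_action G (topspace X) \<phi> \<and> (\<forall>g\<in>carrier G. homeomorphic_map X X (\<phi> g))"

definition collapsing ::
    "('a, 'c) monoid_scheme \<Rightarrow> 'x topology \<Rightarrow> ('a \<Rightarrow> 'x \<Rightarrow> 'x) \<Rightarrow> 'a set \<Rightarrow> bool"
  where "collapsing G X \<phi> \<Phi> \<longleftrightarrow>
    \<Phi> \<subseteq> carrier G \<and> infinite \<Phi> \<and>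
    (\<exists>a\<in>topspace X. \<exists>r\<in>topspace X. \<forall>K L.
      compactin X K \<and> K \<subseteq> topspace X - {r} \<and> compactin X L \<and> L \<subseteq> topspace X - {a} \<longrightarrow>
      finite {f\<in>\<Phi>. \<phi> f ` K \<inter> L \<noteq> {}})"

definition convergence_action ::
    "('a, 'c) monoid_scheme \<Rightarrow> 'x topology \<Rightarrow> ('a \<Rightarrow> 'x \<Rightarrow> 'x) \<Rightarrow> bool"
  where "convergence_action G X \<phi> \<longleftrightarrow>
    compact_space X \<and> Hausdorff_space X \<and> action_by_homeomorphisms G X \<phi> \<and>
    (\<forall>\<Phi>. \<Phi> \<subseteq> carrier G \<and> infinite \<Phi> \<longrightarrow> (\<exists>\<Phi>'\<subseteq>\<Phi>. collapsing G X \<phi> \<Phi>'))"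

text \<open>The space and the action are arguments of \<open>convergence_group\<close>: a definition cannot
  quantify over the type of points, and being elementary refers to the given action.\<close>

definition convergence_group ::
    "('a, 'c) monoid_scheme \<Rightarrow> 'x topology \<Rightarrow> ('a \<Rightarrow> 'x \<Rightarrow> 'x) \<Rightarrow> bool"
  where "convergence_group G X \<phi> \<longleftrightarrow>
    convergence_action G X \<phi> \<and> metrizable_space X \<and>
    (\<exists>x\<in>topspace X. \<exists>y\<in>topspace X. \<exists>z\<in>topspace X. x \<noteq> y \<and> x \<noteq> z \<and> y \<noteq> z)"

definition elementary ::
    "('a, 'c) monoid_scheme \<Rightarrow> 'x topology \<Rightarrow> ('a \<Rightarrow> 'x \<Rightarrow> 'x) \<Rightarrow> bool"
  where "elementary G X \<phi> \<longleftrightarrow>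
    finite (carrier G) \<or>
    (\<exists>A\<subseteq>topspace X. A \<noteq> {} \<and> finite A \<and> card A \<le> 2 \<and> (\<forall>g\<in>carrier G. \<phi> g ` A = A))"

section \<open>Invariable generation\<close>

definition conjugate :: "('a, 'c) monoid_scheme \<Rightarrow> 'a \<Rightarrow> 'a \<Rightarrow> 'a"
  where "conjugate G s g = inv\<^bsub>G\<^esub> g \<otimes>\<^bsub>G\<^esub> s \<otimes>\<^bsub>G\<^esub> g"

definition conjugacy_class :: "('a, 'c) monoid_scheme \<Rightarrow> 'a \<Rightarrow> 'a set"
  where "conjugacy_class G s = conjugate G s ` carrier G"

definition invariably_generates :: "('a, 'c) monoid_scheme \<Rightarrow> 'a set \<Rightarrow> bool"
  where "invariably_generates G S \<longleftrightarrow>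
    S \<subseteq> carrier G \<and>
    (\<forall>g\<in>S \<rightarrow> carrier G. generate G ((\<lambda>s. conjugate G s (g s)) ` S) = carrier G)"

definition invariably_generated :: "('a, 'c) monoid_scheme \<Rightarrow> bool"
  where "invariably_generated G \<longleftrightarrow> (\<exists>S. invariably_generates G S)"

end

theory Submission
  imports Defs
begin

text \<open>
  The subgroup is generated by one well-chosen representative of each conjugacy class. The
  representatives play ping-pong, each with its own region of the limit set \<open>L\<close>. Under the
  subgroup, a point of \<open>L\<close> outside all regions can only stay put or enter a region; but every orbit of the whole group comes close to
  every point of \<open>L\<close>, so the subgroup is proper as soon as the regions leave some room.

  Three properties of the action make this work. First, the group is countable
  (\<open>countable_carrier\<close>), so its conjugacy classes can be assigned to the members of a sequence of
  disjoint open sets \<open>W n\<close> that meet \<open>L\<close> (\<open>disjoint_open_sequence\<close>). Secondly, the action is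
  extremely proximal: if \<open>V\<close> and \<open>W\<close> are open and meet \<open>L\<close>, then some group element \<open>t\<close> sends
  everything outside \<open>V\<close> into \<open>W\<close> (\<open>extremely_proximal\<close>). This is the collapsing property, with the
  repelling point moved into \<open>V\<close> and the attracting point moved into \<open>W\<close> by minimality of \<open>L\<close>.
  Thirdly, for every element \<open>g\<close> there is an open set \<open>V\<close> meeting \<open>L\<close> that is disjoint from its
  translates by all powers of \<open>g\<close> acting nontrivially on \<open>L\<close>
  (\<open>commutative_subgroup_wandering_set\<close>). Conjugating \<open>g\<close> by \<open>t\<close> then turns the wandering set \<open>V\<close>
  inside out: the powers of the conjugate that act nontrivially on \<open>L\<close> send \<open>L - W\<close> into \<open>W\<close>.
  No distinction between elliptic, parabolic and loxodromic elements is involved.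

  Elements that act trivially on \<open>L\<close> cannot take part in such a game, even when they are powers
  of a generator. They do no harm: the argument follows the orbit of a point of \<open>L\<close>, and these
  elements do not move it.\<close>

section \<open>Ping-pong for a family of subgroups\<close>

text \<open>The points that are reached from \<open>p\<close> by applying letters from the sets \<open>D i\<close>, never two
  in a row from the same one. The index records the set of the last letter applied, \<open>None\<close>
  standing for the empty word. Only letters acting nontrivially on \<open>L\<close> count as letters, because
  only these play ping-pong.\<close>

inductive alternating_orbit ::
    "('a \<Rightarrow> 'x \<Rightarrow> 'x) \<Rightarrow> 'x set \<Rightarrow> ('i \<Rightarrow> 'a set) \<Rightarrow> 'x \<Rightarrow> 'i option \<Rightarrow> 'x \<Rightarrow> bool"
  for \<phi> L D p where
  base: "alternating_orbit \<phi> L D p None p"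
| step: "alternating_orbit \<phi> L D p j x \<Longrightarrow> j \<noteq> Some i \<Longrightarrow> c \<in> D i \<Longrightarrow> \<exists>y\<in>L. \<phi> c y \<noteq> y
          \<Longrightarrow> alternating_orbit \<phi> L D p (Some i) (\<phi> c x)"

context group_action
begin

lemma group_G: "group G"
  using group_hom group_hom.axioms(1) by auto

lemma action_closed: "g \<in> carrier G \<Longrightarrow> x \<in> E \<Longrightarrow> \<phi> g x \<in> E"
  using element_image by blast

lemma action_one: "x \<in> E \<Longrightarrow> \<phi> \<one> x = x"
  using id_eq_one by (metis restrict_apply')

lemma action_inv_cancel:
  assumes "g \<in> carrier G" "x \<in> E"
  shows "\<phi> (inv g) (\<phi> g x) = x" "\<phi> g (\<phi> (inv g) x) = x"
proof -
  interpret group G by (rule group_G)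
  show "\<phi> (inv g) (\<phi> g x) = x" using orbit_sym_aux assms by blast
  show "\<phi> g (\<phi> (inv g) x) = x" using orbit_sym_aux[of "inv g"] assms by auto
qed

lemma action_inj:
  "g \<in> carrier G \<Longrightarrow> x \<in> E \<Longrightarrow> y \<in> E \<Longrightarrow> \<phi> g x = \<phi> g y \<longleftrightarrow> x = y"
  using inj_prop by (meson inj_on_eq_iff)

lemma generate_preserves_set:
  assumes "D \<subseteq> carrier G" "S \<subseteq> E"
    and D: "\<And>c x. c \<in> D \<Longrightarrow> x \<in> S \<Longrightarrow> \<phi> c x \<in> S"
    and inv_D: "\<And>c. c \<in> D \<Longrightarrow> inv c \<in> D"
    and "h \<in> generate G D" "x \<in> S"
  shows "\<phi> h x \<in> S"
  using assms(5,6)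
proof (induction arbitrary: x rule: generate.induct)
  case one
  then show ?case using action_one assms(2) by auto
next
  case (incl h)
  then show ?case using D by auto
next
  case (inv h)
  then show ?case using D inv_D by auto
next
  case (eng h1 h2)
  have "h1 \<in> carrier G" "h2 \<in> carrier G"
    using eng.hyps assms(1) group.generate_in_carrier[OF group_G] by auto
  then have "\<phi> (h1 \<otimes> h2) x = \<phi> h1 (\<phi> h2 x)"
    using composition_rule eng.prems assms(2) by blast
  then show ?case using eng by auto
qed

text \<open>A point reached by an alternating word lies in the region of its last letter, by the rules of
  the game. It therefore suffices that the set of these points is preserved by every \<open>D i\<close>. Working
  with points instead of words makes letters that are trivial on \<open>L\<close> disappear by themselves,
  although the subgroups \<open>D i\<close> may intersect in such elements.\<close>

lemma ping_pong_orbit: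
  fixes D :: "'i \<Rightarrow> 'a set"
  assumes sub: "\<And>i. subgroup (D i) G"
    and L: "L \<subseteq> E" and p: "p \<in> L" "\<And>i. p \<notin> W i"
    and disj: "\<And>i j. i \<noteq> j \<Longrightarrow> W i \<inter> W j = {}"
    and play: "\<And>i c x. c \<in> D i \<Longrightarrow> \<exists>y\<in>L. \<phi> c y \<noteq> y \<Longrightarrow> x \<in> L - W i \<Longrightarrow> \<phi> c x \<in> L \<inter> W i"
    and h: "h \<in> generate G (\<Union>i. D i)"
  shows "\<phi> h p = p \<or> (\<exists>i. \<phi> h p \<in> W i)"
proof -
  interpret group G by (rule group_G)
  let ?R = "alternating_orbit \<phi> L D p"
  have R: "x \<in> L \<and> (case j of None \<Rightarrow> x = p | Some i \<Rightarrow> x \<in> W i)" if "?R j x" for j x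
    using that
  proof induction
    case base
    then show ?case using p by auto
  next
    case (step j x i c)
    have "x \<notin> W i"
      using step p disj by (cases j) auto
    then show ?case using play step by auto
  qed
  define S where "S = {x. \<exists>j. ?R j x}"
  have SL: "S \<subseteq> L" using R by (auto simp: S_def)
  have DG: "D i \<subseteq> carrier G" for i using sub subgroup.subset by blast
  have inv: "\<phi> c x \<in> S" if c: "c \<in> D i" and x: "x \<in> S" for c x i
  proof -
    obtain j where j: "?R j x" using x by (auto simp: S_def)
    show ?thesis
    proof (cases "j = Some i")
      case False
      show ?thesis
      proof (cases "\<exists>y\<in>L. \<phi> c y \<noteq> y")
        case True
        then show ?thesis using alternating_orbit.step[OF j False c] by (auto simp: S_def)
      next
        case False
        then have "\<phi> c x = x" using SL x by auto
        then show ?thesis using x by simp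
      qed
    next
      case True
      \<comment> \<open>The outermost letter of the word already lies in \<open>D i\<close>, so it absorbs \<open>c\<close>.\<close>
      from j True obtain j' x' c' where *: "?R j' x'" "j' \<noteq> Some i" "c' \<in> D i" "x = \<phi> c' x'"
        by (auto elim: alternating_orbit.cases)
      have cc: "c \<otimes> c' \<in> D i" using sub c *(3) subgroup.m_closed by metis
      have x': "x' \<in> L" "x' \<in> S" using R[OF *(1)] *(1) by (auto simp: S_def)
      have eq: "\<phi> c x = \<phi> (c \<otimes> c') x'"
        using composition_rule[of x' c c'] x' L c *(3,4) DG by (metis subsetD)
      show ?thesis
      proof (cases "\<exists>y\<in>L. \<phi> (c \<otimes> c') y \<noteq> y")
        case True
        then show ?thesis using alternating_orbit.step[OF *(1,2) cc] eq by (auto simp: S_def)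
      next
        case False
        then show ?thesis using eq x' by auto
      qed
    qed
  qed
  have "\<phi> h p \<in> S"
  proof (rule generate_preserves_set[where D = "\<Union>i. D i"])
    show "(\<Union>i. D i) \<subseteq> carrier G" "S \<subseteq> E" using DG SL L by auto
    show "p \<in> S" unfolding S_def by (blast intro: alternating_orbit.base)
    show "\<And>c. c \<in> (\<Union>i. D i) \<Longrightarrow> inv c \<in> (\<Union>i. D i)"
      using sub subgroup.m_inv_closed by fastforce
  qed (use inv h in auto)
  then obtain j where "?R j (\<phi> h p)" by (auto simp: S_def)
  from R[OF this] show ?thesis by (cases j) auto
qed

end

section \<open>Collapsing sequences\<close>

locale convergence_dynamics =
  fixes G (structure) and X :: "'x topology" and \<phi> :: "'a \<Rightarrow> 'x \<Rightarrow> 'x"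
  assumes convergence: "convergence_action G X \<phi>"
    and three_points: "\<exists>x\<in>topspace X. \<exists>y\<in>topspace X. \<exists>z\<in>topspace X. x \<noteq> y \<and> x \<noteq> z \<and> y \<noteq> z"
begin

sublocale group_action G "topspace X" \<phi>
  using convergence by (simp add: convergence_action_def action_by_homeomorphisms_def)

sublocale group G
  by (rule group_G)

lemma Hausdorff: "Hausdorff_space X"
  using convergence by (simp add: convergence_action_def)

lemma compact: "compact_space X"
  using convergence by (simp add: convergence_action_def)

lemma closedin_finite: "finite F \<Longrightarrow> F \<subseteq> topspace X \<Longrightarrow> closedin X F"
  using Hausdorff Hausdorff_imp_t1_space t1_space_closedin_finite by blast

lemma separate_points:
  assumes "x \<in> topspace X" "y \<in> topspace X" "x \<noteq> y"
  obtains A B where "openin X A" "openin X B" "x \<in> A" "y \<in> B" "A \<inter> B = {}"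
  using Hausdorff assms unfolding Hausdorff_space_def disjnt_def by meson

lemma openin_translate:
  assumes "g \<in> carrier G" "openin X U"
  shows "openin X (\<phi> g ` U)"
proof -
  have "homeomorphic_map X X (\<phi> g)"
    using convergence assms(1) by (simp add: convergence_action_def action_by_homeomorphisms_def)
  then have "open_map X X (\<phi> g)" by (rule homeomorphic_imp_open_map)
  then show ?thesis using assms(2) by (simp add: open_map_def)
qed

text \<open>The collapsing property in terms of neighbourhoods: the elements of \<open>\<Phi>\<close> converge to the
  constant \<open>a\<close> uniformly away from neighbourhoods of \<open>r\<close>. Here \<open>a\<close> is the attracting and \<open>r\<close> the
  repelling point.\<close>

definition collapses :: "'a set \<Rightarrow> 'x \<Rightarrow> 'x \<Rightarrow> bool" where
  "collapses \<Phi> a r \<longleftrightarrow> \<Phi> \<subseteq> carrier G \<and> infinite \<Phi> \<and> a \<in> topspace X \<and> r \<in> topspace X \<and>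
    (\<forall>U V. openin X U \<and> a \<in> U \<and> openin X V \<and> r \<in> V \<longrightarrow>
      finite {f\<in>\<Phi>. \<not> \<phi> f ` (topspace X - V) \<subseteq> U})"

lemma infinite_imp_collapses:
  assumes "\<Psi> \<subseteq> carrier G" "infinite \<Psi>"
  obtains \<Phi> a r where "\<Phi> \<subseteq> \<Psi>" "collapses \<Phi> a r"
proof -
  have "\<forall>\<Psi>. \<Psi> \<subseteq> carrier G \<and> infinite \<Psi> \<longrightarrow> (\<exists>\<Phi>\<subseteq>\<Psi>. collapsing G X \<phi> \<Phi>)"
    using convergence by (simp add: convergence_action_def)
  then obtain \<Phi> where \<Phi>: "\<Phi> \<subseteq> \<Psi>" "collapsing G X \<phi> \<Phi>"
    using assms by meson
  then obtain a r where ar: "a \<in> topspace X" "r \<in> topspace X"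
    and fin: "\<forall>K L. compactin X K \<and> K \<subseteq> topspace X - {r} \<and> compactin X L \<and>
      L \<subseteq> topspace X - {a} \<longrightarrow> finite {f\<in>\<Phi>. \<phi> f ` K \<inter> L \<noteq> {}}"
    unfolding collapsing_def by auto
  have "finite {f\<in>\<Phi>. \<not> \<phi> f ` (topspace X - V) \<subseteq> U}"
    if "openin X U" "a \<in> U" "openin X V" "r \<in> V" for U V
  proof -
    have cpt: "compactin X (topspace X - A)" if "openin X A" for A
      using that compact by (intro closedin_compact_space closedin_diff) auto
    have "finite {f\<in>\<Phi>. \<phi> f ` (topspace X - V) \<inter> (topspace X - U) \<noteq> {}}"
      using that by (intro fin[rule_format] conjI cpt) auto
    moreover have "{f\<in>\<Phi>. \<not> \<phi> f ` (topspace X - V) \<subseteq> U}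
        \<subseteq> {f\<in>\<Phi>. \<phi> f ` (topspace X - V) \<inter> (topspace X - U) \<noteq> {}}"
      using \<Phi> assms(1) action_closed by blast
    ultimately show ?thesis using finite_subset by blast
  qed
  then have "collapses \<Phi> a r"
    using ar \<Phi>(2) unfolding collapses_def collapsing_def by auto
  then show ?thesis using that \<Phi> by blast
qed

lemma collapses_exists_map:
  assumes "collapses \<Phi> a r" "openin X U" "a \<in> U" "openin X V" "r \<in> V"
  shows "\<exists>f\<in>\<Phi>. \<phi> f ` (topspace X - V) \<subseteq> U"
proof (rule ccontr)
  assume "\<not> ?thesis"
  then have "{f\<in>\<Phi>. \<not> \<phi> f ` (topspace X - V) \<subseteq> U} = \<Phi>" by auto
  moreover have "finite {f\<in>\<Phi>. \<not> \<phi> f ` (topspace X - V) \<subseteq> U}" "infinite \<Phi>"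
    using assms unfolding collapses_def by auto
  ultimately show False by simp
qed

lemma collapses_exists_pair:
  assumes "collapses \<Phi> a r" "openin X U" "a \<in> U"
    and "x \<in> topspace X" "y \<in> topspace X" "x \<noteq> r" "y \<noteq> r"
  shows "\<exists>f\<in>\<Phi>. \<phi> f x \<in> U \<and> \<phi> f y \<in> U"
proof -
  have "openin X (topspace X - {x,y})"
    using closedin_finite[of "{x,y}"] assms by auto
  moreover have "r \<in> topspace X - {x,y}"
    using assms unfolding collapses_def by auto
  ultimately obtain f where "f \<in> \<Phi>" "\<phi> f ` (topspace X - (topspace X - {x,y})) \<subseteq> U"
    using collapses_exists_map[OF assms(1-3)] by blast
  then show ?thesis using assms by blast
qed

lemma collapses_limit_in_closed:
  assumes "collapses \<Phi> a r" "closedin X F" "x \<in> topspace X" "x \<noteq> r"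
    and "\<And>f. f \<in> \<Phi> \<Longrightarrow> \<phi> f x \<in> F"
  shows "a \<in> F"
proof (rule ccontr)
  assume "a \<notin> F"
  moreover have "a \<in> topspace X" using assms(1) by (simp add: collapses_def)
  ultimately have "\<exists>f\<in>\<Phi>. \<phi> f x \<in> topspace X - F \<and> \<phi> f x \<in> topspace X - F"
    using assms by (intro collapses_exists_pair[OF assms(1)]) auto
  then show False using assms(5) by blast
qed

lemma collapses_fixed_point:
  assumes "collapses \<Phi> a r" "x \<in> topspace X" "\<And>f. f \<in> \<Phi> \<Longrightarrow> \<phi> f x = x"
  shows "x = a \<or> x = r"
proof (cases "x = r")
  case False
  have "closedin X {x}" using closedin_finite assms(2) by simp
  then have "a \<in> {x}"
    using collapses_limit_in_closed[OF assms(1) _ assms(2) False] assms(3) by blast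
  then show ?thesis by simp
qed simp

text \<open>\<open>f\<close> maps the complement of \<open>U\<close> into \<open>V\<close> exactly when its inverse maps the complement of
  \<open>V\<close> into \<open>U\<close>; so inversion exchanges the attracting and the repelling point.\<close>

lemma collapses_inverse:
  assumes "collapses \<Phi> a r"
  shows "collapses (m_inv G ` \<Phi>) r a"
proof -
  have \<Phi>: "\<Phi> \<subseteq> carrier G" "infinite \<Phi>" "a \<in> topspace X" "r \<in> topspace X"
    using assms by (auto simp: collapses_def)
  have "inj_on (m_inv G) \<Phi>" using \<Phi>(1) inj_on_subset[OF inv_inj] by simp
  then have "infinite (m_inv G ` \<Phi>)" using \<Phi>(2) by (simp add: finite_image_iff)
  moreover have "finite {f \<in> m_inv G ` \<Phi>. \<not> \<phi> f ` (topspace X - V) \<subseteq> U}"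
    if "openin X U" "r \<in> U" "openin X V" "a \<in> V" for U V
  proof -
    have "{f \<in> m_inv G ` \<Phi>. \<not> \<phi> f ` (topspace X - V) \<subseteq> U}
        \<subseteq> m_inv G ` {f\<in>\<Phi>. \<not> \<phi> f ` (topspace X - U) \<subseteq> V}"
    proof
      fix g assume "g \<in> {f \<in> m_inv G ` \<Phi>. \<not> \<phi> f ` (topspace X - V) \<subseteq> U}"
      then obtain f x where f: "f \<in> \<Phi>" "g = inv f"
        and x: "x \<in> topspace X" "x \<notin> V" "\<phi> (inv f) x \<notin> U"
        by blast
      have "\<phi> f (\<phi> (inv f) x) = x" "\<phi> (inv f) x \<in> topspace X"
        using action_inv_cancel action_closed x f \<Phi> by auto
      then have "\<not> \<phi> f ` (topspace X - U) \<subseteq> V" using x by fastforce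
      then show "g \<in> m_inv G ` {f\<in>\<Phi>. \<not> \<phi> f ` (topspace X - U) \<subseteq> V}" using f by auto
    qed
    moreover have "finite {f\<in>\<Phi>. \<not> \<phi> f ` (topspace X - U) \<subseteq> V}"
      using assms that unfolding collapses_def by blast
    ultimately show ?thesis using finite_subset by blast
  qed
  ultimately show ?thesis using \<Phi> unfolding collapses_def by auto
qed

text \<open>For generic \<open>x\<close>, both \<open>x\<close> and \<open>h x\<close> are attracted to \<open>a\<close>, while \<open>f (h x) = h (f x)\<close> is also
  close to \<open>h a\<close>.\<close>

lemma centralizer_fixes_attractor:
  assumes "collapses \<Phi> a r" "h \<in> carrier G" "\<And>f. f \<in> \<Phi> \<Longrightarrow> h \<otimes> f = f \<otimes> h"
  shows "\<phi> h a = a"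
proof (rule ccontr)
  assume ne: "\<phi> h a \<noteq> a"
  have \<Phi>: "\<Phi> \<subseteq> carrier G" "a \<in> topspace X" "r \<in> topspace X"
    using assms by (auto simp: collapses_def)
  obtain A B where AB: "openin X A" "openin X B" "\<phi> h a \<in> A" "a \<in> B" "A \<inter> B = {}"
    using separate_points[of "\<phi> h a" a] ne \<Phi>(2) action_closed[OF assms(2)] by blast
  \<comment> \<open>Neither \<open>x\<close> nor \<open>h x\<close> may be the repelling point.\<close>
  obtain x where x: "x \<in> topspace X" "x \<noteq> r" "x \<noteq> \<phi> (inv h) r"
    using three_points by metis
  have hx: "\<phi> h x \<in> topspace X" "\<phi> h x \<noteq> r"
    using x assms(2) action_closed action_inv_cancel(1) by auto
  define U where "U = B \<inter> \<phi> (inv h) ` A"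
  have "openin X U" using AB assms(2) openin_translate unfolding U_def by auto
  moreover have "a \<in> U" using AB \<Phi> assms(2) action_inv_cancel(1)[of h a]
    unfolding U_def by (metis IntI image_eqI)
  ultimately obtain f where f: "f \<in> \<Phi>" "\<phi> f x \<in> U" "\<phi> f (\<phi> h x) \<in> U"
    using collapses_exists_pair[OF assms(1)] x hx by metis
  have fG: "f \<in> carrier G" using f \<Phi> by auto
  from f(2) obtain y where y: "y \<in> A" "\<phi> f x = \<phi> (inv h) y" by (auto simp: U_def)
  have "\<phi> f (\<phi> h x) = \<phi> h (\<phi> f x)"
    using composition_rule[OF x(1) assms(2) fG] composition_rule[OF x(1) fG assms(2)] assms(3)[OF f(1)]
    by simp
  also have "\<dots> = y"
    using y openin_subset[OF AB(1)] action_inv_cancel(2)[OF assms(2)] by auto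
  finally show False using y AB f(3) by (auto simp: U_def)
qed

lemma centralizer_fixes_repeller:
  assumes "collapses \<Phi> a r" "h \<in> carrier G" "\<And>f. f \<in> \<Phi> \<Longrightarrow> h \<otimes> f = f \<otimes> h"
  shows "\<phi> h r = r"
proof (rule centralizer_fixes_attractor[OF collapses_inverse[OF assms(1)] assms(2)])
  fix f assume "f \<in> m_inv G ` \<Phi>"
  then obtain k where k: "k \<in> \<Phi>" "f = inv k" by auto
  then have "k \<in> carrier G" using assms(1) by (auto simp: collapses_def)
  then have "h \<otimes> inv k = inv k \<otimes> (k \<otimes> h) \<otimes> inv k"
    using assms(2) by (simp add: m_assoc[symmetric])
  also have "\<dots> = inv k \<otimes> (h \<otimes> k) \<otimes> inv k"
    using assms(3)[OF k(1)] by simp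
  also have "\<dots> = inv k \<otimes> h"
    using \<open>k \<in> carrier G\<close> assms(2) by (simp add: m_assoc)
  finally show "h \<otimes> f = f \<otimes> h"
    using k by simp
qed

text \<open>A collapsing set of elements can only fix its attracting and its repelling point.\<close>

lemma triple_stabilizer_finite:
  assumes "x \<in> topspace X" "y \<in> topspace X" "z \<in> topspace X" "x \<noteq> y" "x \<noteq> z" "y \<noteq> z"
  shows "finite {g \<in> carrier G. \<phi> g x = x \<and> \<phi> g y = y \<and> \<phi> g z = z}"
proof (rule ccontr)
  assume "\<not> ?thesis"
  then obtain \<Phi> a r where \<Phi>: "\<Phi> \<subseteq> {g \<in> carrier G. \<phi> g x = x \<and> \<phi> g y = y \<and> \<phi> g z = z}"
      "collapses \<Phi> a r"
    using infinite_imp_collapses by (metis (no_types, lifting) mem_Collect_eq subsetI)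
  have "x = a \<or> x = r" "y = a \<or> y = r" "z = a \<or> z = r"
    using collapses_fixed_point[OF \<Phi>(2)] \<Phi>(1) assms by blast+
  then show False using assms by auto
qed

text \<open>A collapsing set moves two of three given points arbitrarily close to each other. Hence only
  finitely many elements keep the three points at mutual distances of at least \<open>1 / (n + 1)\<close>, and
  every element does so for some \<open>n\<close>.\<close>

lemma countable_carrier:
  assumes "metrizable_space X"
  shows "countable (carrier G)"
proof -
  obtain M d where "Metric_space M d" and X: "X = Metric_space.mtopology M d"
    using assms unfolding metrizable_space_def by auto
  then interpret Metric_space M d by simp
  have M: "topspace X = M" using X by simp
  obtain x y z where xyz: "x \<in> M" "y \<in> M" "z \<in> M" "x \<noteq> y" "x \<noteq> z" "y \<noteq> z"
    using three_points M by auto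
  define S where "S n = {g \<in> carrier G. d (\<phi> g x) (\<phi> g y) \<ge> inverse (real (Suc n)) \<and>
      d (\<phi> g x) (\<phi> g z) \<ge> inverse (real (Suc n)) \<and> d (\<phi> g y) (\<phi> g z) \<ge> inverse (real (Suc n))}" for n
  have "finite (S n)" for n
  proof (rule ccontr)
    assume "infinite (S n)"
    then obtain \<Phi> a r where \<Phi>: "\<Phi> \<subseteq> S n" "collapses \<Phi> a r"
      using infinite_imp_collapses[of "S n"] by (auto simp: S_def)
    define e where "e = inverse (real (Suc n)) / 2"
    have e: "e > 0" "2 * e = inverse (real (Suc n))" by (auto simp: e_def)
    have aM: "a \<in> M" using \<Phi>(2) M by (auto simp: collapses_def)
    have close: "\<exists>f\<in>\<Phi>. d (\<phi> f u) (\<phi> f v) < inverse (real (Suc n))"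
      if uv: "u \<in> M" "v \<in> M" "u \<noteq> r" "v \<noteq> r" for u v
    proof -
      have "openin X (mball a e)" "a \<in> mball a e" using X aM e by auto
      then obtain f where f: "f \<in> \<Phi>" "\<phi> f u \<in> mball a e" "\<phi> f v \<in> mball a e"
        using collapses_exists_pair[OF \<Phi>(2)] uv M by metis
      then have "d (\<phi> f u) (\<phi> f v) < inverse (real (Suc n))"
        using triangle'[of "\<phi> f u" a "\<phi> f v"] e commute[of a] by auto
      then show ?thesis using f by auto
    qed
    consider "x \<noteq> r" "y \<noteq> r" | "x \<noteq> r" "z \<noteq> r" | "y \<noteq> r" "z \<noteq> r" using xyz by metis
    then show False
    proof cases
      case 1 then show False using close[of x y] xyz \<Phi>(1) by (fastforce simp: S_def)
    next
      case 2 then show False using close[of x z] xyz \<Phi>(1) by (fastforce simp: S_def)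
    next
      case 3 then show False using close[of y z] xyz \<Phi>(1) by (fastforce simp: S_def)
    qed
  qed
  moreover have "carrier G \<subseteq> (\<Union>n. S n)"
  proof
    fix g assume g: "g \<in> carrier G"
    define m where "m = Min {d (\<phi> g x) (\<phi> g y), d (\<phi> g x) (\<phi> g z), d (\<phi> g y) (\<phi> g z)}"
    have "m > 0"
      using g xyz M action_inj[OF g] action_closed[OF g] by (auto simp: m_def mdist_pos_eq)
    then obtain n where "inverse (real (Suc n)) < m" using reals_Archimedean by blast
    then have "g \<in> S n" using g by (auto simp: S_def m_def)
    then show "g \<in> (\<Union>n. S n)" by auto
  qed
  ultimately show ?thesis
    by (metis countable_UN countable_finite countable_subset countableI_type)
qed

end

section \<open>The limit set\<close>

locale nonelementary_convergence = convergence_dynamics G X \<phi>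
  for G (structure) and X :: "'x topology" and \<phi> :: "'a \<Rightarrow> 'x \<Rightarrow> 'x" +
  assumes nonelementary: "\<not> elementary G X \<phi>"
begin

definition invariant_closed :: "'x set \<Rightarrow> bool" where
  "invariant_closed M \<longleftrightarrow> closedin X M \<and> M \<noteq> {} \<and> (\<forall>g\<in>carrier G. \<phi> g ` M \<subseteq> M)"

text \<open>The smallest nonempty closed invariant set. That it is nonempty is due to the collapsing
  property: it contains every attracting and every repelling point.\<close>

definition limit_set :: "'x set" where
  "limit_set = \<Inter>{M. invariant_closed M}"

lemma infinite_carrier: "infinite (carrier G)"
  using nonelementary by (auto simp: elementary_def)

lemma invariant_not_small:
  assumes "M \<subseteq> topspace X" "M \<noteq> {}" "\<And>g. g \<in> carrier G \<Longrightarrow> \<phi> g ` M \<subseteq> M" "finite M"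
  shows "card M \<ge> 3"
proof (rule ccontr)
  assume "\<not> ?thesis"
  moreover have "\<phi> g ` M = M" if "g \<in> carrier G" for g
    using assms that inj_on_subset[OF inj_prop] by (meson endo_inj_surj)
  ultimately have "elementary G X \<phi>"
    unfolding elementary_def using assms by (intro disjI2 exI[of _ M]) auto
  then show False using nonelementary by simp
qed

lemma invariant_closed_topspace: "invariant_closed (topspace X)"
  unfolding invariant_closed_def using three_points action_closed by auto

lemma limit_set_subset: "limit_set \<subseteq> topspace X"
  using invariant_closed_topspace by (auto simp: limit_set_def)

lemma limit_set_invariant: "g \<in> carrier G \<Longrightarrow> x \<in> limit_set \<Longrightarrow> \<phi> g x \<in> limit_set"
  by (auto simp: limit_set_def invariant_closed_def)

text \<open>A closed invariant set contains a point other than \<open>r\<close>, and the images of this point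
  accumulate at \<open>a\<close>.\<close>

lemma attractor_in_limit_set:
  assumes "collapses \<Phi> a r"
  shows "a \<in> limit_set"
  unfolding limit_set_def
proof clarify
  fix M assume M: "invariant_closed M"
  then have MX: "M \<subseteq> topspace X" using closedin_subset by (auto simp: invariant_closed_def)
  have "M \<noteq> {r}"
    using invariant_not_small[of "{r}"] M MX by (auto simp: invariant_closed_def)
  then obtain x where x: "x \<in> M" "x \<noteq> r" using M by (auto simp: invariant_closed_def)
  show "a \<in> M"
  proof (rule collapses_limit_in_closed[OF assms _ _ x(2)])
    show "closedin X M" "x \<in> topspace X" using M MX x by (auto simp: invariant_closed_def)
    show "\<phi> f x \<in> M" if "f \<in> \<Phi>" for f
      using that assms M x(1) unfolding invariant_closed_def collapses_def by blast
  qed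
qed

lemma repeller_in_limit_set: "collapses \<Phi> a r \<Longrightarrow> r \<in> limit_set"
  using collapses_inverse attractor_in_limit_set by blast

text \<open>The limit set lies in the closure of every orbit. If the orbit of \<open>x\<close> missed \<open>W\<close>, then the
  complement of the translates of \<open>W\<close> would be a closed invariant set containing \<open>x\<close>, and so it
  would contain the limit set.\<close>

lemma orbit_meets_open:
  assumes "x \<in> topspace X" "openin X W" "W \<inter> limit_set \<noteq> {}"
  shows "\<exists>g\<in>carrier G. \<phi> g x \<in> W"
proof (rule ccontr)
  assume no: "\<not> ?thesis"
  define U where "U = (\<Union>g\<in>carrier G. \<phi> g ` W)"
  have WX: "W \<subseteq> topspace X" using assms openin_subset by auto
  have U: "openin X U" unfolding U_def using assms openin_translate by blast
  have x: "x \<notin> U"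
  proof
    assume "x \<in> U"
    then obtain g w where "g \<in> carrier G" "w \<in> W" "x = \<phi> g w" by (auto simp: U_def)
    then have "\<phi> (inv g) x \<in> W" using WX action_inv_cancel by auto
    then show False using no \<open>g \<in> carrier G\<close> by auto
  qed
  have "\<phi> g y \<in> topspace X - U" if "g \<in> carrier G" "y \<in> topspace X - U" for g y
  proof -
    have "\<phi> g y \<notin> U"
    proof
      assume "\<phi> g y \<in> U"
      then obtain k w where k: "k \<in> carrier G" "w \<in> W" "\<phi> g y = \<phi> k w" by (auto simp: U_def)
      then have "\<phi> (inv g \<otimes> k) w = y"
        using composition_rule[of w "inv g" k] WX that action_inv_cancel(1)[of g y] by auto
      moreover have "inv g \<otimes> k \<in> carrier G" using that k by auto
      ultimately have "y \<in> U" using k unfolding U_def by blast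
      then show False using that by auto
    qed
    then show ?thesis using that action_closed by auto
  qed
  then have "invariant_closed (topspace X - U)"
    using U x assms(1) unfolding invariant_closed_def by blast
  then have "limit_set \<subseteq> topspace X - U" by (auto simp: limit_set_def)
  moreover have "W \<subseteq> U"
    using action_one WX unfolding U_def by force
  ultimately show False using assms by auto
qed

text \<open>In a finite limit set the attracting point \<open>a\<close> is isolated, and a collapsing element would
  send two distinct points exactly to \<open>a\<close>.\<close>

lemma limit_set_infinite: "infinite limit_set"
proof
  assume fin: "finite limit_set"
  obtain \<Phi> a r where \<Phi>: "collapses \<Phi> a r"
    by (rule infinite_imp_collapses[OF subset_refl infinite_carrier])
  have a: "a \<in> limit_set" using attractor_in_limit_set \<Phi> by blast
  have "card limit_set \<ge> 3"
    using a fin limit_set_subset limit_set_invariant by (intro invariant_not_small) auto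
  then have "card (limit_set - {r}) \<ge> 2" using repeller_in_limit_set[OF \<Phi>] fin by auto
  then obtain x y where xy: "x \<in> limit_set - {r}" "y \<in> limit_set - {r}" "x \<noteq> y"
    by (meson card_2_iff' ex_card subsetD)
  have "openin X (topspace X - (limit_set - {a}))"
    using closedin_finite[of "limit_set - {a}"] fin limit_set_subset by auto
  then obtain f where f: "f \<in> \<Phi>" "\<phi> f x \<in> topspace X - (limit_set - {a})"
      "\<phi> f y \<in> topspace X - (limit_set - {a})"
    using collapses_exists_pair[OF \<Phi>, of "topspace X - (limit_set - {a})" x y]
      a xy limit_set_subset by blast
  have "f \<in> carrier G" using f \<Phi> by (auto simp: collapses_def)
  then have "\<phi> f x = a" "\<phi> f y = a" using f xy limit_set_invariant by blast+
  then show False using action_inj[OF \<open>f \<in> carrier G\<close>, of x y] xy limit_set_subset by auto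
qed

text \<open>Minimality moves a repelling point into \<open>V\<close> and an attracting point into \<open>W\<close>; a collapsing
  element in between does the rest.\<close>

lemma extremely_proximal:
  assumes V: "openin X V" "V \<inter> limit_set \<noteq> {}" and W: "openin X W" "W \<inter> limit_set \<noteq> {}"
  shows "\<exists>t\<in>carrier G. \<phi> t ` (topspace X - V) \<subseteq> W"
proof -
  obtain \<Phi> a r where \<Phi>: "collapses \<Phi> a r"
    by (rule infinite_imp_collapses[OF subset_refl infinite_carrier])
  then have ar: "a \<in> topspace X" "r \<in> topspace X" "\<Phi> \<subseteq> carrier G" by (auto simp: collapses_def)
  obtain u where u: "u \<in> carrier G" "\<phi> u r \<in> V" using orbit_meets_open ar V by metis
  obtain v where v: "v \<in> carrier G" "\<phi> v a \<in> W" using orbit_meets_open ar W by metis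
  have "openin X (\<phi> (inv v) ` W)" "openin X (\<phi> (inv u) ` V)"
    using u v V W openin_translate by auto
  moreover have "a \<in> \<phi> (inv v) ` W" "r \<in> \<phi> (inv u) ` V"
    using u v ar action_inv_cancel(1) by (metis image_eqI)+
  ultimately obtain f where f: "f \<in> \<Phi>" "\<phi> f ` (topspace X - \<phi> (inv u) ` V) \<subseteq> \<phi> (inv v) ` W"
    using collapses_exists_map[OF \<Phi>] by metis
  have fG: "f \<in> carrier G" using f ar by auto
  define t where "t = v \<otimes> (f \<otimes> inv u)"
  have "\<phi> t x \<in> W" if x: "x \<in> topspace X" "x \<notin> V" for x
  proof -
    have "\<phi> (inv u) x \<in> topspace X - \<phi> (inv u) ` V"
      using x u V(1) openin_subset[OF V(1)] action_inj[of "inv u" x] action_closed by auto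
    then obtain w where w: "w \<in> W" "\<phi> f (\<phi> (inv u) x) = \<phi> (inv v) w" using f(2) by blast
    have "\<phi> t x = \<phi> v (\<phi> f (\<phi> (inv u) x))"
      using composition_rule[of x] x u v fG unfolding t_def by auto
    also have "\<dots> = w" using w action_inv_cancel(2) v openin_subset[OF W(1)] by auto
    finally show ?thesis using w by simp
  qed
  moreover have "t \<in> carrier G" using u v fG by (auto simp: t_def)
  ultimately show ?thesis by blast
qed

text \<open>The limit set has no isolated points: extreme proximality pushes two of its points into
  \<open>W\<close> at once.\<close>

lemma open_meets_limit_set_twice:
  assumes W: "openin X W" "W \<inter> limit_set \<noteq> {}"
  obtains x y where "x \<in> W \<inter> limit_set" "y \<in> W \<inter> limit_set" "x \<noteq> y"
proof -
  obtain x where x: "x \<in> limit_set" using W by auto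
  obtain y where y: "y \<in> limit_set" "y \<noteq> x"
    using limit_set_infinite infinite_imp_nonempty[of "limit_set - {x}"] by auto
  have "infinite (limit_set - {x,y})" using limit_set_infinite by simp
  then have "limit_set - {x,y} \<noteq> {}" using infinite_imp_nonempty by blast
  then have "(topspace X - {x,y}) \<inter> limit_set \<noteq> {}" using limit_set_subset by blast
  moreover have "openin X (topspace X - {x,y})"
    using closedin_finite[of "{x,y}"] x y limit_set_subset by auto
  ultimately obtain t where t: "t \<in> carrier G" "\<phi> t ` (topspace X - (topspace X - {x,y})) \<subseteq> W"
    using extremely_proximal W by metis
  then have "\<phi> t x \<in> W \<inter> limit_set" "\<phi> t y \<in> W \<inter> limit_set"
    using x y limit_set_subset limit_set_invariant by blast+
  moreover have "\<phi> t x \<noteq> \<phi> t y" using action_inj[OF t(1), of x y] x y limit_set_subset by auto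
  ultimately show ?thesis using that by blast
qed

lemma disjoint_open_sequence:
  "\<exists>W :: nat \<Rightarrow> 'x set. (\<forall>n. openin X (W n) \<and> W n \<inter> limit_set \<noteq> {}) \<and>
    (\<forall>m n. m \<noteq> n \<longrightarrow> W m \<inter> W n = {})"
proof -
  let ?good = "\<lambda>U. openin X U \<and> U \<inter> limit_set \<noteq> {}"
  have split: "\<exists>A B. ?good A \<and> ?good B \<and> A \<inter> B = {} \<and> A \<subseteq> U \<and> B \<subseteq> U" if U: "?good U" for U
  proof -
    obtain x y where xy: "x \<in> U \<inter> limit_set" "y \<in> U \<inter> limit_set" "x \<noteq> y"
      using open_meets_limit_set_twice U by metis
    then obtain A B where "openin X A" "openin X B" "x \<in> A" "y \<in> B" "A \<inter> B = {}"
      using separate_points[of x y] limit_set_subset by blast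
    then have "?good (U \<inter> A) \<and> ?good (U \<inter> B) \<and> (U \<inter> A) \<inter> (U \<inter> B) = {} \<and> U \<inter> A \<subseteq> U \<and> U \<inter> B \<subseteq> U"
      using U xy by blast
    then show ?thesis by blast
  qed
  \<comment> \<open>The second component is the region kept in reserve for the later sets.\<close>
  have "\<exists>f. \<forall>n. (?good (fst (f n)) \<and> ?good (snd (f n)) \<and> fst (f n) \<inter> snd (f n) = {}) \<and>
      fst (f (Suc n)) \<subseteq> snd (f n) \<and> snd (f (Suc n)) \<subseteq> snd (f n)"
  proof (rule dependent_nat_choice)
    have "?good (topspace X)"
      using limit_set_infinite limit_set_subset by (auto simp: Int_absorb1)
    from split[OF this]
    show "\<exists>x. ?good (fst x) \<and> ?good (snd x) \<and> fst x \<inter> snd x = {}"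
      by (metis fst_conv snd_conv)
  next
    fix x :: "'x set \<times> 'x set" and n :: nat
    assume "?good (fst x) \<and> ?good (snd x) \<and> fst x \<inter> snd x = {}"
    then show "\<exists>y. (?good (fst y) \<and> ?good (snd y) \<and> fst y \<inter> snd y = {}) \<and>
        fst y \<subseteq> snd x \<and> snd y \<subseteq> snd x"
      using split[of "snd x"] by auto
  qed
  then obtain f :: "nat \<Rightarrow> 'x set \<times> 'x set" where f: "\<And>n. ?good (fst (f n))"
      "\<And>n. fst (f n) \<inter> snd (f n) = {}"
      "\<And>n. fst (f (Suc n)) \<subseteq> snd (f n)" "\<And>n. snd (f (Suc n)) \<subseteq> snd (f n)"
    by blast
  have anti: "snd (f n) \<subseteq> snd (f m)" if "m \<le> n" for m n
    using lift_Suc_antimono_le[of "\<lambda>n. snd (f n)"] f(4) that by blast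
  have "fst (f m) \<inter> fst (f n) = {}" if mn: "m < n" for m n
  proof -
    obtain k where "n = Suc k" "m \<le> k" using mn by (cases n) auto
    then have "fst (f n) \<subseteq> snd (f m)" using f(3)[of k] anti[of m k] by auto
    then show ?thesis using f(2)[of m] by blast
  qed
  then have "\<forall>m n. m \<noteq> n \<longrightarrow> fst (f m) \<inter> fst (f n) = {}"
    by (metis Int_commute linorder_neqE_nat)
  then show ?thesis using f(1) by (intro exI[of _ "\<lambda>n. fst (f n)"]) simp
qed

section \<open>Wandering sets for commutative subgroups\<close>

text \<open>Suppose that \<open>c\<close> fixes \<open>V \<inter> L\<close> pointwise, where \<open>L\<close> is the limit set. By extreme proximality
  \<open>c\<close> has conjugates that fix any prescribed finite subset \<open>F\<close> of \<open>L\<close>. Once \<open>F\<close> contains three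
  points, these conjugates lie in the finite group \<open>S\<close> stabilizing them. If \<open>F\<close> also contains, for
  each element of \<open>S\<close> that is nontrivial on \<open>L\<close>, a point that it moves, then the conjugate must be
  trivial on \<open>L\<close>, and so must be \<open>c\<close>.\<close>

lemma moves_point_in_open:
  assumes c: "c \<in> carrier G" "\<exists>y\<in>limit_set. \<phi> c y \<noteq> y"
    and V: "openin X V" "V \<inter> limit_set \<noteq> {}"
  shows "\<exists>x\<in>V \<inter> limit_set. \<phi> c x \<noteq> x"
proof (rule ccontr)
  assume "\<not> ?thesis"
  then have fixV: "\<And>x. x \<in> V \<inter> limit_set \<Longrightarrow> \<phi> c x = x" by blast
  obtain T where T: "T \<subseteq> limit_set" "card T = 3" 
    using limit_set_infinite infinite_arbitrarily_large by blast
  then obtain x y z where xyz: "T = {x,y,z}" "x \<noteq> y" "x \<noteq> z" "y \<noteq> z"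
    by (auto simp: card_3_iff)
  define S where "S = {g \<in> carrier G. \<phi> g x = x \<and> \<phi> g y = y \<and> \<phi> g z = z}"
  have "finite S" unfolding S_def
    using T(1) xyz limit_set_subset by (intro triple_stabilizer_finite) auto
  have "\<exists>q. \<forall>s. s \<in> S \<and> (\<exists>y\<in>limit_set. \<phi> s y \<noteq> y) \<longrightarrow> q s \<in> limit_set \<and> \<phi> s (q s) \<noteq> q s"
    by (rule choice) blast
  then obtain q where q: "\<And>s. s \<in> S \<Longrightarrow> \<exists>y\<in>limit_set. \<phi> s y \<noteq> y \<Longrightarrow>
      q s \<in> limit_set \<and> \<phi> s (q s) \<noteq> q s"
    by blast
  define F where "F = T \<union> (q ` S \<inter> limit_set)"
  have F: "finite F" "F \<subseteq> limit_set" using \<open>finite S\<close> T by (auto simp: F_def xyz)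
  have "openin X (topspace X - F)"
    using closedin_finite F limit_set_subset by blast
  moreover have "infinite (limit_set - F)" using limit_set_infinite F by simp
  then have "limit_set - F \<noteq> {}" using infinite_imp_nonempty by blast
  then have "(topspace X - F) \<inter> limit_set \<noteq> {}" using limit_set_subset by blast
  ultimately obtain t where t: "t \<in> carrier G" "\<phi> t ` (topspace X - V) \<subseteq> topspace X - F"
    using extremely_proximal V by metis
  define s where "s = t \<otimes> (c \<otimes> inv t)"
  have sG: "s \<in> carrier G" using t c by (auto simp: s_def)
  have s_act: "\<phi> s x = \<phi> t (\<phi> c (\<phi> (inv t) x))" if "x \<in> topspace X" for x
    using that t c composition_rule[of x t "c \<otimes> inv t"] composition_rule[of x c "inv t"]
    unfolding s_def by simp
  have s_fix: "\<phi> s x = x" if "x \<in> F" for x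
  proof -
    have x: "x \<in> limit_set" "x \<in> topspace X" using that F limit_set_subset by auto
    have "\<phi> (inv t) x \<in> limit_set" using x t limit_set_invariant by auto
    moreover have "\<phi> (inv t) x \<in> V"
    proof (rule ccontr)
      assume "\<phi> (inv t) x \<notin> V"
      then have "\<phi> t (\<phi> (inv t) x) \<in> topspace X - F"
        using t(2) action_closed[OF inv_closed[OF t(1)] x(2)] by blast
      then show False using action_inv_cancel(2)[OF t(1) x(2)] that by simp
    qed
    ultimately show ?thesis using fixV s_act x t action_inv_cancel(2) by auto
  qed
  have "s \<in> S" using s_fix sG unfolding S_def F_def xyz by auto
  moreover have "\<exists>y\<in>limit_set. \<phi> s y \<noteq> y"
  proof -
    obtain y where y: "y \<in> limit_set" "\<phi> c y \<noteq> y" using c by auto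
    have yX: "y \<in> topspace X" using y limit_set_subset by auto
    have "\<phi> s (\<phi> t y) = \<phi> t (\<phi> c y)"
      using s_act[of "\<phi> t y"] yX t action_closed action_inv_cancel(1) by auto
    then have "\<phi> s (\<phi> t y) \<noteq> \<phi> t y"
      using action_inj[OF t(1)] y yX action_closed[OF c(1)] by auto
    then show ?thesis using y t limit_set_invariant by blast
  qed
  ultimately have "q s \<in> F" "\<phi> s (q s) \<noteq> q s" using q unfolding F_def by auto
  then show False using s_fix by auto
qed

text \<open>All points occurring as attracting or repelling points of subsets of \<open>C\<close> are fixed by \<open>C\<close>,
  by commutativity, and hence belong to the pair \<open>{a, r}\<close> of any single collapsing subset. Away
  from this pair the action of \<open>C\<close> is properly discontinuous, and the limit set is infinite.\<close>

lemma commutative_subgroup_discontinuous_somewhere: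
  assumes "C \<subseteq> carrier G" "\<And>g h. g \<in> C \<Longrightarrow> h \<in> C \<Longrightarrow> g \<otimes> h = h \<otimes> g"
  shows "\<exists>V. openin X V \<and> V \<inter> limit_set \<noteq> {} \<and> finite {c\<in>C. \<phi> c ` V \<inter> V \<noteq> {}}"
proof (cases "finite C")
  case True
  have "topspace X \<inter> limit_set \<noteq> {}"
    using limit_set_infinite limit_set_subset by (auto simp: Int_absorb1)
  then show ?thesis using True by (intro exI[of _ "topspace X"]) auto
next
  case False
  obtain \<Phi> a r where \<Phi>: "\<Phi> \<subseteq> C" "collapses \<Phi> a r"
    using infinite_imp_collapses assms(1) False by blast
  have ar: "a \<in> topspace X" "r \<in> topspace X" using \<Phi> by (auto simp: collapses_def)
  have "infinite (limit_set - {a,r})" using limit_set_infinite by simp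
  then obtain p where p: "p \<in> limit_set" "p \<noteq> a" "p \<noteq> r"
    using infinite_imp_nonempty by blast
  then have pX: "p \<in> topspace X" using limit_set_subset by auto
  obtain A A' where A: "openin X A" "openin X A'" "a \<in> A" "p \<in> A'" "A \<inter> A' = {}"
    using separate_points[OF ar(1) pX] p by metis
  obtain R R' where R: "openin X R" "openin X R'" "r \<in> R" "p \<in> R'" "R \<inter> R' = {}"
    using separate_points[OF ar(2) pX] p by metis
  define V where "V = A' \<inter> R'"
  define U where "U = A \<union> R"
  have V: "openin X V" "openin X U" "p \<in> V" "V \<inter> U = {}" "V \<subseteq> topspace X"
    using A R openin_subset[OF A(2)] by (auto simp: V_def U_def)
  have "finite {c\<in>C. \<phi> c ` V \<inter> V \<noteq> {}}"
  proof (rule ccontr)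
    assume "infinite {c\<in>C. \<phi> c ` V \<inter> V \<noteq> {}}"
    then obtain \<Psi> b s where \<Psi>: "\<Psi> \<subseteq> {c\<in>C. \<phi> c ` V \<inter> V \<noteq> {}}" "collapses \<Psi> b s"
      using infinite_imp_collapses assms(1) by (metis (no_types, lifting) mem_Collect_eq subset_iff)
    have bs: "b \<in> topspace X" "s \<in> topspace X" using \<Psi> by (auto simp: collapses_def)
    have "\<phi> h b = b" "\<phi> h s = s" if "h \<in> C" for h
      using \<Psi>(1) assms that
      by (auto intro!: centralizer_fixes_attractor[OF \<Psi>(2)] centralizer_fixes_repeller[OF \<Psi>(2)])
    then have "b = a \<or> b = r" "s = a \<or> s = r"
      using collapses_fixed_point[OF \<Phi>(2)] bs \<Phi>(1) by blast+
    then have "b \<in> U" "s \<in> U" using A R by (auto simp: U_def)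
    then obtain f where f: "f \<in> \<Psi>" "\<phi> f ` (topspace X - U) \<subseteq> U"
      using collapses_exists_map[OF \<Psi>(2)] V by metis
    then have "\<phi> f ` V \<inter> V = {}" using V by blast
    then show False using f \<Psi> by auto
  qed
  then show ?thesis using V p by blast
qed

text \<open>A point of \<open>V\<close> that \<open>c\<close> moves has a neighbourhood that \<open>c\<close> moves off itself. Such points
  exist in every open set meeting the limit set, so finitely many elements can be treated one
  after the other.\<close>

lemma shrink_wandering:
  assumes "finite B" "B \<subseteq> carrier G" "\<And>c. c \<in> B \<Longrightarrow> \<exists>y\<in>limit_set. \<phi> c y \<noteq> y"
    and "openin X V" "V \<inter> limit_set \<noteq> {}"
  shows "\<exists>V'\<subseteq>V. openin X V' \<and> V' \<inter> limit_set \<noteq> {} \<and> (\<forall>c\<in>B. \<phi> c ` V' \<inter> V' = {})"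
  using assms(1-3)
proof (induction B)
  case empty
  then show ?case using assms by auto
next
  case (insert c B)
  then obtain V' where V': "V' \<subseteq> V" "openin X V'" "V' \<inter> limit_set \<noteq> {}"
      "\<forall>c\<in>B. \<phi> c ` V' \<inter> V' = {}"
    by auto
  have c: "c \<in> carrier G" "\<exists>y\<in>limit_set. \<phi> c y \<noteq> y" using insert.prems by auto
  obtain x where x: "x \<in> V'" "x \<in> limit_set" "\<phi> c x \<noteq> x"
    using moves_point_in_open[OF c V'(2,3)] by auto
  have xX: "x \<in> topspace X" using x limit_set_subset by auto
  obtain P Q where PQ: "openin X P" "openin X Q" "\<phi> c x \<in> P" "x \<in> Q" "P \<inter> Q = {}"
    using separate_points[OF action_closed[OF c(1) xX] xX x(3)] by blast
  define V'' where "V'' = V' \<inter> Q \<inter> \<phi> (inv c) ` P"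
  have "openin X V''" unfolding V''_def using V' PQ c openin_translate by auto
  moreover have "x \<in> V''" unfolding V''_def
    using x PQ action_inv_cancel(1)[OF c(1) xX] by (metis IntI image_eqI)
  moreover have "\<phi> c ` V'' \<subseteq> P"
    unfolding V''_def using action_inv_cancel(2)[OF c(1)] openin_subset[OF PQ(1)] by auto
  then have "\<phi> c ` V'' \<inter> V'' = {}" using PQ(5) by (auto simp: V''_def)
  moreover have "V'' \<subseteq> V'" by (auto simp: V''_def)
  ultimately show ?case using V'(1,4) x
    by (intro exI[of _ V'']) blast
qed

lemma commutative_subgroup_wandering_set:
  assumes "C \<subseteq> carrier G" "\<And>g h. g \<in> C \<Longrightarrow> h \<in> C \<Longrightarrow> g \<otimes> h = h \<otimes> g"
  obtains V where "openin X V" "V \<inter> limit_set \<noteq> {}"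
    "\<And>c. c \<in> C \<Longrightarrow> \<exists>y\<in>limit_set. \<phi> c y \<noteq> y \<Longrightarrow> \<phi> c ` V \<inter> V = {}"
proof -
  obtain V0 where V0: "openin X V0" "V0 \<inter> limit_set \<noteq> {}" "finite {c\<in>C. \<phi> c ` V0 \<inter> V0 \<noteq> {}}"
    using commutative_subgroup_discontinuous_somewhere[OF assms] by blast
  define B where "B = {c\<in>C. \<phi> c ` V0 \<inter> V0 \<noteq> {} \<and> (\<exists>y\<in>limit_set. \<phi> c y \<noteq> y)}"
  have "finite B" by (rule finite_subset[OF _ V0(3)]) (auto simp: B_def)
  then obtain V where V: "V \<subseteq> V0" "openin X V" "V \<inter> limit_set \<noteq> {}" "\<forall>c\<in>B. \<phi> c ` V \<inter> V = {}"
  proof -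
    have "B \<subseteq> carrier G" using assms(1) by (auto simp: B_def)
    moreover have "\<exists>y\<in>limit_set. \<phi> c y \<noteq> y" if "c \<in> B" for c using that by (simp add: B_def)
    ultimately show ?thesis
      using shrink_wandering[OF \<open>finite B\<close> _ _ V0(1,2)] that by metis
  qed
  have "\<phi> c ` V \<inter> V = {}" if "c \<in> C" "\<exists>y\<in>limit_set. \<phi> c y \<noteq> y" for c
  proof (cases "c \<in> B")
    case False
    then have "\<phi> c ` V0 \<inter> V0 = {}" using that by (simp add: B_def)
    then show ?thesis using V(1) by blast
  qed (use V(4) in blast)
  then show ?thesis using that V by blast
qed

section \<open>A proper subgroup meeting every conjugacy class\<close>

text \<open>Let \<open>V\<close> be wandering for the powers of \<open>g\<close>, and let \<open>t\<close> send the complement of \<open>V\<close> into \<open>W\<close>.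
  The representative is \<open>h = t g t\<inverse>\<close>: a point outside \<open>W\<close> is pulled back by \<open>t\<close> into \<open>V\<close>, moved
  out of \<open>V\<close> by a power of \<open>g\<close>, and then sent into \<open>W\<close> by \<open>t\<close>.\<close>

lemma conjugate_into_ping_pong_position:
  assumes g: "g \<in> carrier G" and W: "openin X W" "W \<inter> limit_set \<noteq> {}"
  obtains h where "h \<in> conjugacy_class G g" "h \<in> carrier G"
    "\<And>c x. c \<in> generate G {h} \<Longrightarrow> \<exists>y\<in>limit_set. \<phi> c y \<noteq> y \<Longrightarrow> x \<in> limit_set - W \<Longrightarrow>
      \<phi> c x \<in> limit_set \<inter> W"
proof -
  let ?C = "generate G {g}"
  have C: "?C = {g [^] (k::int) | k. k \<in> UNIV}" using generate_pow g by auto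
  have CG: "?C \<subseteq> carrier G" using g generate_incl by auto
  have "x \<otimes> y = y \<otimes> x" if "x \<in> ?C" "y \<in> ?C" for x y
    using that g by (auto simp: C int_pow_mult[symmetric] add.commute)
  then obtain V where V: "openin X V" "V \<inter> limit_set \<noteq> {}"
    "\<And>c. c \<in> ?C \<Longrightarrow> \<exists>y\<in>limit_set. \<phi> c y \<noteq> y \<Longrightarrow> \<phi> c ` V \<inter> V = {}"
    using commutative_subgroup_wandering_set[OF CG] by metis
  obtain t where t: "t \<in> carrier G" "\<phi> t ` (topspace X - V) \<subseteq> W"
    using extremely_proximal V W by metis
  define h where "h = t \<otimes> g \<otimes> inv t"
  have hG: "h \<in> carrier G" using g t by (auto simp: h_def)
  have "h = conjugate G g (inv t)" using t by (simp add: h_def conjugate_def)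
  then have "h \<in> conjugacy_class G g" using t by (auto simp: conjugacy_class_def)
  moreover have "\<phi> c x \<in> limit_set \<inter> W"
    if c: "c \<in> generate G {h}" "\<exists>y\<in>limit_set. \<phi> c y \<noteq> y" and x: "x \<in> limit_set - W" for c x
  proof -
    have cG: "c \<in> carrier G" using c(1) hG generate_in_carrier[of "{h}"] by auto
    have "subgroup ((\<lambda>c. t \<otimes> c \<otimes> inv t) ` ?C) G"
    proof (rule subgroupI)
      have one: "\<one> \<in> ?C" by (rule generate.one)
      show "(\<lambda>c. t \<otimes> c \<otimes> inv t) ` ?C \<subseteq> carrier G" using CG t by auto
      show "(\<lambda>c. t \<otimes> c \<otimes> inv t) ` ?C \<noteq> {}" using one by auto
    next
      fix a assume "a \<in> (\<lambda>c. t \<otimes> c \<otimes> inv t) ` ?C"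
      then obtain c where c: "c \<in> ?C" "a = t \<otimes> c \<otimes> inv t" by auto
      then have "inv a = t \<otimes> inv c \<otimes> inv t"
        using CG t by (auto simp: inv_mult_group m_assoc)
      moreover have "inv c \<in> ?C" using c g generate_m_inv_closed[of "{g}"] by auto
      ultimately show "inv a \<in> (\<lambda>c. t \<otimes> c \<otimes> inv t) ` ?C" by auto
    next
      fix a b assume "a \<in> (\<lambda>c. t \<otimes> c \<otimes> inv t) ` ?C" "b \<in> (\<lambda>c. t \<otimes> c \<otimes> inv t) ` ?C"
      then obtain c d where cd: "c \<in> ?C" "a = t \<otimes> c \<otimes> inv t" "d \<in> ?C" "b = t \<otimes> d \<otimes> inv t" by auto
      then have cdG: "c \<in> carrier G" "d \<in> carrier G" using CG by auto
      have "inv t \<otimes> (t \<otimes> (d \<otimes> inv t)) = d \<otimes> inv t"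
        using cdG t by (simp add: m_assoc[symmetric])
      then have "a \<otimes> b = t \<otimes> (c \<otimes> d) \<otimes> inv t" using cdG cd t by (simp add: m_assoc)
      moreover have "c \<otimes> d \<in> ?C" using cd generate.eng by metis
      ultimately show "a \<otimes> b \<in> (\<lambda>c. t \<otimes> c \<otimes> inv t) ` ?C" by auto
    qed
    moreover have "{h} \<subseteq> (\<lambda>c. t \<otimes> c \<otimes> inv t) ` ?C"
      using generate.incl[of g "{g}" G] by (auto simp: h_def)
    ultimately have "c \<in> (\<lambda>c. t \<otimes> c \<otimes> inv t) ` ?C"
      using generate_subgroup_incl c(1) by blast
    then obtain c' where c': "c' \<in> ?C" "c = t \<otimes> c' \<otimes> inv t" by auto
    have c'G: "c' \<in> carrier G" using c' CG by auto
    have act: "\<phi> c z = \<phi> t (\<phi> c' (\<phi> (inv t) z))" if "z \<in> topspace X" for z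
      using that c'(2) c'G t composition_rule[of z "t \<otimes> c'" "inv t"]
        composition_rule[of "\<phi> (inv t) z" t c'] action_closed[of "inv t" z] by simp
    have xX: "x \<in> topspace X" using x limit_set_subset by auto
    have "\<exists>y\<in>limit_set. \<phi> c' y \<noteq> y"
    proof -
      obtain y where y: "y \<in> limit_set" "\<phi> c y \<noteq> y" using c by auto
      have "\<phi> c' (\<phi> (inv t) y) \<noteq> \<phi> (inv t) y"
        using y act[of y] action_inv_cancel(2)[OF t(1), of y] limit_set_subset by auto
      then show ?thesis using y t limit_set_invariant by (meson inv_closed)
    qed
    then have disj: "\<phi> c' ` V \<inter> V = {}" using V(3) c' by blast
    have "\<phi> (inv t) x \<in> V"
    proof (rule ccontr)
      assume "\<phi> (inv t) x \<notin> V"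
      then have "\<phi> t (\<phi> (inv t) x) \<in> W"
        using t(2) action_closed[OF inv_closed[OF t(1)] xX] by blast
      then show False using action_inv_cancel(2)[OF t(1) xX] x by simp
    qed
    then have "\<phi> c' (\<phi> (inv t) x) \<notin> V" using disj by blast
    moreover have "\<phi> c' (\<phi> (inv t) x) \<in> topspace X" using xX t c'G action_closed by auto
    ultimately have "\<phi> c x \<in> W" using t(2) act[OF xX] by auto
    then show ?thesis using limit_set_invariant[OF cG] x by auto
  qed
  ultimately show ?thesis using that hG by blast
qed

theorem proper_subgroup_meeting_conjugacy_classes:
  assumes "metrizable_space X"
  shows "\<exists>H. subgroup H G \<and> H \<noteq> carrier G \<and> (\<forall>g\<in>carrier G. H \<inter> conjugacy_class G g \<noteq> {})"
proof -
  define e where "e = from_nat_into (carrier G)"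
  have e: "range e = carrier G"
    unfolding e_def using countable_carrier[OF assms] by (intro range_from_nat_into) auto
  obtain W :: "nat \<Rightarrow> 'x set" where W: "\<And>n. openin X (W n)" "\<And>n. W n \<inter> limit_set \<noteq> {}"
      "\<And>m n. m \<noteq> n \<Longrightarrow> W m \<inter> W n = {}"
    using disjoint_open_sequence by blast
  let ?P = "\<lambda>n h. h \<in> conjugacy_class G (e n) \<and> h \<in> carrier G \<and>
    (\<forall>c\<in>generate G {h}. \<forall>x. (\<exists>y\<in>limit_set. \<phi> c y \<noteq> y) \<longrightarrow> x \<in> limit_set - W (n + 2) \<longrightarrow>
      \<phi> c x \<in> limit_set \<inter> W (n + 2))"
  have "\<exists>h. ?P n h" for n
  proof -
    have "e n \<in> carrier G" using e by auto
    from conjugate_into_ping_pong_position[OF this W(1) W(2), of "n + 2"]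
    show ?thesis by metis
  qed
  then obtain h where h: "\<And>n. ?P n (h n)" by metis
  define H where "H = generate G (\<Union>n. generate G {h n})"
  have sub: "subgroup (generate G {h n}) G" for n using h generate_is_subgroup by auto
  have H: "subgroup H G"
    unfolding H_def using sub subgroup.subset by (intro generate_is_subgroup) blast
  have "h n \<in> H" for n unfolding H_def by (blast intro: generate.incl)
  then have meets: "\<forall>g\<in>carrier G. H \<inter> conjugacy_class G g \<noteq> {}"
    using h e by (metis IntI empty_iff imageE)
  \<comment> \<open>The sets \<open>W 0\<close> and \<open>W 1\<close> are kept out of the game: the orbit under \<open>H\<close> of a point of
    \<open>W 0\<close> never reaches \<open>W 1\<close>, but its orbit under the whole group does.\<close>
  obtain p where p: "p \<in> W 0" "p \<in> limit_set" using W(2)[of 0] by auto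
  obtain g where g: "g \<in> carrier G" "\<phi> g p \<in> W 1"
    using orbit_meets_open[OF _ W(1) W(2)] p limit_set_subset by (metis subsetD)
  have "g \<notin> H"
  proof
    assume "g \<in> H"
    then have "\<phi> g p = p \<or> (\<exists>i. \<phi> g p \<in> W (i + 2))"
      unfolding H_def
    proof (intro ping_pong_orbit[where L = limit_set and D = "\<lambda>n. generate G {h n}"])
      show "p \<notin> W (i + 2)" for i using W(3)[of 0 "i + 2"] p by auto
      show "W (i + 2) \<inter> W (j + 2) = {}" if "i \<noteq> j" for i j :: nat using W(3) that by auto
      show "\<phi> c x \<in> limit_set \<inter> W (i + 2)"
        if "c \<in> generate G {h i}" "\<exists>y\<in>limit_set. \<phi> c y \<noteq> y" "x \<in> limit_set - W (i + 2)" for i c x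
        using h[of i] that by blast
    qed (use sub limit_set_subset p in auto)
    moreover have "W 1 \<inter> W (i + 2) = {}" for i by (rule W(3)) simp
    moreover have "p \<notin> W 1" using W(3)[of 0 1] p by auto
    ultimately show False using g(2) by auto
  qed
  then show ?thesis using H meets g(1) by blast
qed

end

text \<open>Choosing for each element of a generating set a conjugate in \<open>H\<close> generates at most \<open>H\<close>.\<close>

lemma (in group) not_invariably_generated:
  assumes H: "subgroup H G" "H \<noteq> carrier G" "\<And>x. x \<in> carrier G \<Longrightarrow> H \<inter> conjugacy_class G x \<noteq> {}"
  shows "\<not> invariably_generated G"
proof
  assume "invariably_generated G"
  then obtain S where S: "S \<subseteq> carrier G"
    and gen: "\<And>g. g \<in> S \<rightarrow> carrier G \<Longrightarrow> generate G ((\<lambda>s. conjugate G s (g s)) ` S) = carrier G"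
    unfolding invariably_generated_def invariably_generates_def by blast
  have "\<forall>s\<in>S. \<exists>g. g \<in> carrier G \<and> conjugate G s g \<in> H"
    using H(3) S unfolding conjugacy_class_def by blast
  then obtain g where g: "\<And>s. s \<in> S \<Longrightarrow> g s \<in> carrier G \<and> conjugate G s (g s) \<in> H"
    by metis
  have "generate G ((\<lambda>s. conjugate G s (g s)) ` S) \<subseteq> H"
    using g H(1) by (intro generate_subgroup_incl) auto
  then have "carrier G \<subseteq> H" using gen[of g] g by auto
  then show False using H subgroup.subset by blast
qed

theorem corollary1p2:
  fixes G :: "('a, 'c) monoid_scheme"
    and X :: "'x topology"
    and \<phi> :: "'a \<Rightarrow> 'x \<Rightarrow> 'x"
  assumes "convergence_group G X \<phi>"
    and "\<not> elementary G X \<phi>"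
  shows "\<not> invariably_generated G \<and>
    (\<exists>H. subgroup H G \<and> H \<noteq> carrier G \<and>
      (\<forall>x\<in>carrier G. H \<inter> conjugacy_class G x \<noteq> {}))"
proof -
  interpret nonelementary_convergence G X \<phi>
    using assms by unfold_locales (auto simp: convergence_group_def)
  have "metrizable_space X" using assms by (simp add: convergence_group_def)
  then obtain H where "subgroup H G" "H \<noteq> carrier G"
      "\<forall>g\<in>carrier G. H \<inter> conjugacy_class G g \<noteq> {}"
    using proper_subgroup_meeting_conjugacy_classes by blast
  then show ?thesis using not_invariably_generated by blast
qed

end
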